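(* Let $(X,d)$ be a complete metric space and let $1\le p<\infty$. Suppose $(\mu_i)_{i=1}^\infty$ is a sequence of compactly supported Borel probability measures in $X$ and $\mu\in\mathscr P(X)$ is such that $W_p(\mu_i,\mu)\to0$ as $i\to\infty$. Then $$m(r):=\inf_{i\in\mathbb N}\ \inf_{x\in\operatorname{supp}\mu_i}\mu_i(B(x,r))>0\qquad\text{for all }r>0$$ if and only if $d_H(\operatorname{supp}\mu_i,\operatorname{supp}\mu)\to0$ as $i\to\infty$.
   Context: $\mathscr P(X)$ is the set of Borel probability measures on $X$; $\operatorname{supp}\mu$ is the support of $\mu$, i.e. the smallest closed set of full $\mu$-measure. $B(x,r)$ is the open ball of center $x$ and radius $r$. $W_p(\mu,\nu)=\inf_{\lambda\in\Pi(\mu,\nu)}\big(\int d^p(x,y)\,\mathrm{d}\lambda(x,y)\big)^{1/p}$, where $\Pi(\mu,\nu)$ is the set of Borel probability measures on $X\times X$ with marginals $\mu$ and $\nu$. The Hausdorff distance between closed sets is $d_H(A,B)=\max\big(\sup_{x\in A}\operatorname{dist}(x,B),\sup_{y\in B}\operatorname{dist}(y,A)\big)$. *)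

theory Defs
  imports "HOL-Analysis.Analysis" "HOL-Probability.Probability"
begin

definition borel_prob :: "'a::topological_space measure \<Rightarrow> bool" where
  "borel_prob \<mu> \<longleftrightarrow> sets \<mu> = sets borel \<and> prob_space \<mu>"

text \<open>The smallest closed set of full measure. On a non-separable space such a set need
  not exist, in which case the value below is unspecified; this is why full
  measure is required explicitly in \<open>compactly_supported\<close>, so that
  the predicate forces the smallest set to exist.\<close>

definition supp :: "'a::topological_space measure \<Rightarrow> 'a set" where
  "supp \<mu> = (LEAST C. closed C \<and> emeasure \<mu> C = emeasure \<mu> (space \<mu>))"

definition compactly_supported :: "'a::topological_space measure \<Rightarrow> bool" where
  "compactly_supported \<mu> \<longleftrightarrow>
     compact (supp \<mu>) \<and> emeasure \<mu> (supp \<mu>) = emeasure \<mu> (space \<mu>)"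

text \<open>Couplings live on the Borel sets of the product space, which for non-separable spaces
  may be strictly finer than the product \<sigma>-algebra \<open>borel \<Otimes>\<^sub>M borel\<close>.\<close>

definition couplings ::
    "'a::topological_space measure \<Rightarrow> 'a measure \<Rightarrow> ('a \<times> 'a) measure set" where
  "couplings \<mu> \<nu> =
     {\<kappa>. borel_prob \<kappa> \<and> distr \<kappa> borel fst = \<mu> \<and> distr \<kappa> borel snd = \<nu>}"

definition ennreal_powr :: "ennreal \<Rightarrow> real \<Rightarrow> ennreal" where
  "ennreal_powr x a = (if x = \<infinity> then \<infinity> else ennreal (enn2real x powr a))"
  \<comment> \<open>intended for exponents \<open>a > 0\<close>\<close>

text \<open>The value is infinite when no coupling has finite cost.\<close>

definition wasserstein ::
    "real \<Rightarrow> 'a::metric_space measure \<Rightarrow> 'a measure \<Rightarrow> ennreal" where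
  "wasserstein p \<mu> \<nu> =
     (INF \<kappa>\<in>couplings \<mu> \<nu>.
        ennreal_powr (\<integral>\<^sup>+ z. ennreal (dist (fst z) (snd z) powr p) \<partial>\<kappa>) (1 / p))"

text \<open>Extended-valued, since the sets may be unbounded. \<open>infdist x A\<close> is the usual distance to
  \<open>A\<close> for nonempty \<open>A\<close>, but is \<open>0\<close> by convention when \<open>A\<close> is empty, so
  this is the Hausdorff distance for nonempty sets only.\<close>

definition hausdorff_dist :: "'a::metric_space set \<Rightarrow> 'a set \<Rightarrow> ennreal" where
  "hausdorff_dist A B =
     max (SUP x\<in>A. ennreal (infdist x B)) (SUP y\<in>B. ennreal (infdist y A))"

end

theory Submission
  imports Defs
begin

text \<open>Wasserstein convergence enters only through a Prokhorov-type comparison: by Markov's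
  inequality a coupling of small cost moves little mass over a distance of at least \<open>e\<close>, so
  each of \<open>\<mu>\<^sub>i(A) \<le> \<mu>(B) + \<delta>\<close> and \<open>\<mu>(A) \<le> \<mu>\<^sub>i(B) + \<delta>\<close> holds for large \<open>i\<close> whenever \<open>B\<close>
  contains the \<open>e\<close>-neighbourhood of \<open>A\<close>, uniformly in \<open>A\<close> and \<open>B\<close>
  (\<open>eventually_prokhorov_close\<close>). Supports enter through two properties: balls around support
  points have positive mass, and every set of positive mass meets the support.

  Suppose that \<open>m(r) > 0\<close> for all \<open>r > 0\<close>. A ball around a point of \<open>supp \<mu>\<^sub>i\<close> carries a definite amount of
  \<open>\<mu>\<^sub>i\<close>-mass, hence a slightly larger ball carries \<open>\<mu>\<close>-mass and meets \<open>supp \<mu>\<close>. Conversely, near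
  any point of \<open>supp \<mu>\<close> there are points of \<open>supp \<mu>\<^sub>j\<close> for large \<open>j\<close>, so the uniform lower bound
  is inherited by \<open>\<mu>\<close>, and the same argument with the roles exchanged applies.

  Suppose that the supports converge. Then \<open>supp \<mu>\<close> lies close to some compact \<open>supp \<mu>\<^sub>i\<close> and is
  therefore covered by finitely many small balls, which bounds the \<open>\<mu>\<close>-mass of balls around its
  points from below; closeness of the measures transfers the bound to all large \<open>i\<close>, and each of
  the remaining finitely many measures has a bound of its own by compactness.

  The space may be non-separable, so the existence of \<open>supp \<mu>\<close> needs an argument: \<open>\<mu>\<close> is carried
  by the closure of the union of the compact sets \<open>supp \<mu>\<^sub>i\<close>, which is separable.\<close>

section \<open>Supports of measures carried by separable sets\<close>

lemma borel_prob_measure_simps: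
  assumes "borel_prob \<mu>"
  shows "prob_space \<mu>" "sets \<mu> = sets borel" "space \<mu> = UNIV"
  using assms sets_eq_imp_space_eq[of \<mu> borel] by (auto simp: borel_prob_def)

definition has_support :: "'a::metric_space measure \<Rightarrow> 'a set \<Rightarrow> bool" where
  "has_support \<mu> K \<longleftrightarrow>
     closed K \<and> measure \<mu> K = 1 \<and> (\<forall>x\<in>K. \<forall>r>0. 0 < measure \<mu> (ball x r))"

lemma positive_measure_meets_support:
  assumes "borel_prob \<mu>" and K: "has_support \<mu> K"
    and U: "U \<in> sets borel" "0 < measure \<mu> U"
  shows "\<exists>x\<in>U. x \<in> K"
proof (rule ccontr)
  assume "\<not> ?thesis"
  then have disj: "U \<subseteq> UNIV - K" by blast
  interpret prob_space \<mu> using assms borel_prob_measure_simps by blast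
  note sp = borel_prob_measure_simps(2,3)[OF assms(1)]
  have "K \<in> sets \<mu>" using K sp by (auto simp: has_support_def)
  then have "measure \<mu> (UNIV - K) = 0"
    using K prob_compl[of K] sp by (simp add: has_support_def)
  moreover have "measure \<mu> U \<le> measure \<mu> (UNIV - K)"
    using disj \<open>K \<in> sets \<mu>\<close> sp by (intro finite_measure_mono) auto
  ultimately show False using U by simp
qed

lemma has_support_nonempty:
  assumes "has_support \<mu> K" shows "K \<noteq> {}"
  using assms by (auto simp: has_support_def)

text \<open>Removing from \<open>C\<close> all null balls with rational radius and centre in a countable dense set
  discards only a null set, and what remains is contained in every closed set of full
  measure.\<close>

lemma least_closed_full_measure_exists:
  fixes \<mu> :: "'a::metric_space measure"
  assumes "borel_prob \<mu>" and "closed C" and full: "measure \<mu> C = 1"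
    and D: "countable D" "C \<subseteq> closure D"
  shows "\<exists>S. closed S \<and> measure \<mu> S = 1 \<and>
           (\<forall>C'. closed C' \<and> measure \<mu> C' = 1 \<longrightarrow> S \<subseteq> C')"
proof -
  interpret prob_space \<mu> using assms borel_prob_measure_simps by blast
  note sp = borel_prob_measure_simps(2,3)[OF assms(1)]
  define I where "I = {(d, q). d \<in> D \<and> q \<in> \<rat> \<and> measure \<mu> (ball d q) = 0}"
  define U where "U = (\<Union>(d, q)\<in>I. ball d q)"
  have cI: "countable I"
    by (rule countable_subset[of _ "D \<times> \<rat>"]) (auto simp: I_def D countable_rat)
  have openU: "open U" by (auto simp: U_def)
  have Unull: "measure \<mu> U = 0"
    unfolding U_def
    by (rule measure_eq_0_null_sets, rule null_sets_UN'[OF cI])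
       (auto simp: I_def null_sets_def sp emeasure_eq_measure)
  have meas: "C \<in> sets \<mu>" "U \<in> sets \<mu>" using openU \<open>closed C\<close> sp by auto
  have "measure \<mu> (C - U) = 1"
    using full measure_Diff_null_set[of C \<mu> U] meas Unull
    by (simp add: null_sets_def emeasure_eq_measure)
  moreover have "C - U \<subseteq> C'" if C': "closed C'" "measure \<mu> C' = 1" for C'
  proof
    fix x assume x: "x \<in> C - U"
    show "x \<in> C'"
    proof (rule ccontr)
      assume "x \<notin> C'"
      then obtain e where e: "e > 0" "ball x e \<subseteq> - C'"
        using C' open_contains_ball[of "- C'"] by auto
      have "x \<in> closure D" using x D by auto
      then obtain d where d: "d \<in> D" "dist d x < e / 2"
        using e(1) unfolding closure_approachable by (meson half_gt_zero)
      obtain q where q: "q \<in> \<rat>" "dist d x < q" "q < e / 2"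
        using Rats_dense_in_real[OF d(2)] by auto
      have "ball d q \<subseteq> ball x e"
      proof
        fix y assume "y \<in> ball d q"
        then show "y \<in> ball x e"
          using d q dist_triangle[of x y d] by (simp add: dist_commute)
      qed
      then have "ball d q \<subseteq> UNIV - C'" using e by auto
      moreover have "measure \<mu> (UNIV - C') = 0"
        using C' prob_compl[of C'] sp by simp
      moreover have "measure \<mu> (ball d q) \<le> measure \<mu> (UNIV - C')"
        using calculation C' sp by (intro finite_measure_mono) auto
      ultimately have "measure \<mu> (ball d q) = 0"
        by (simp add: measure_le_0_iff)
      then have "(d, q) \<in> I" using d q by (simp add: I_def)
      then have "x \<in> U" using q by (force simp: U_def)
      then show False using x by simp
    qed
  qed
  ultimately show ?thesis
    using \<open>closed C\<close> openU by (intro exI[of _ "C - U"]) auto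
qed

lemma has_support_supp:
  fixes \<mu> :: "'a::metric_space measure"
  assumes "borel_prob \<mu>" and "closed C" and "measure \<mu> C = 1"
    and "countable D" "C \<subseteq> closure D"
  shows "has_support \<mu> (supp \<mu>)"
proof -
  interpret prob_space \<mu> using assms borel_prob_measure_simps by blast
  note sp = borel_prob_measure_simps(2,3)[OF assms(1)]
  have full_iff: "emeasure \<mu> A = emeasure \<mu> (space \<mu>) \<longleftrightarrow> measure \<mu> A = 1" for A
    by (simp add: emeasure_eq_measure prob_space)
  obtain S where S: "closed S" "measure \<mu> S = 1"
    and least: "\<And>C'. closed C' \<Longrightarrow> measure \<mu> C' = 1 \<Longrightarrow> S \<subseteq> C'"
    using least_closed_full_measure_exists[OF assms] by blast
  have supp: "supp \<mu> = S"
    unfolding supp_def full_iff by (rule Least_equality) (use S least in auto)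
  have "0 < measure \<mu> (ball x r)" if x: "x \<in> S" and "r > 0" for x r
  proof (rule ccontr)
    assume "\<not> ?thesis"
    then have null: "measure \<mu> (ball x r) = 0"
      by (simp add: zero_less_measure_iff)
    have "measure \<mu> (S - ball x r) = 1"
      using measure_Diff_null_set[of S \<mu> "ball x r"] null S sp
      by (simp add: null_sets_def emeasure_eq_measure)
    then have "S \<subseteq> S - ball x r" using S by (intro least) auto
    then show False using x \<open>r > 0\<close> by auto
  qed
  then show ?thesis using S supp by (auto simp: has_support_def)
qed

lemma compact_imp_separable:
  fixes C :: "'a::metric_space set"
  assumes "compact C"
  shows "\<exists>D. countable D \<and> C \<subseteq> closure D"
proof -
  have "\<forall>n. \<exists>F. finite F \<and> C \<subseteq> (\<Union>x\<in>F. ball x (1 / real (Suc n)))"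
    using assms unfolding compact_eq_totally_bounded
    by (metis zero_less_divide_1_iff of_nat_0_less_iff zero_less_Suc)
  then obtain F where F: "\<And>n. finite (F n)" "\<And>n. C \<subseteq> (\<Union>x\<in>F n. ball x (1 / real (Suc n)))"
    by metis
  have "C \<subseteq> closure (\<Union>n. F n)"
  proof
    fix x assume "x \<in> C"
    show "x \<in> closure (\<Union>n. F n)"
      unfolding closure_approachable
    proof (intro allI impI)
      fix e :: real assume "e > 0"
      then obtain n where n: "1 / real (Suc n) < e" using nat_approx_posE by blast
      obtain y where "y \<in> F n" "dist y x < 1 / real (Suc n)"
        using F(2)[of n] \<open>x \<in> C\<close> by auto
      then show "\<exists>y\<in>\<Union>n. F n. dist y x < e" using n by force
    qed
  qed
  moreover have "countable (\<Union>n. F n)" using F by (auto simp: countable_finite)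
  ultimately show ?thesis by blast
qed

text \<open>If no smallest closed set of full measure existed, \<open>supp \<mu>\<close> would be an arbitrary set; but
  compact support forces that set to be compact and of full measure, and then a smallest
  one does exist.\<close>

lemma compactly_supported_has_support:
  fixes \<mu> :: "'a::metric_space measure"
  assumes "borel_prob \<mu>" "compactly_supported \<mu>"
  shows "has_support \<mu> (supp \<mu>)" "compact (supp \<mu>)"
proof -
  interpret prob_space \<mu> using assms borel_prob_measure_simps by blast
  show c: "compact (supp \<mu>)" using assms by (simp add: compactly_supported_def)
  moreover have "measure \<mu> (supp \<mu>) = 1"
    using assms by (simp add: compactly_supported_def emeasure_eq_measure prob_space)
  ultimately show "has_support \<mu> (supp \<mu>)"
    using has_support_supp[OF assms(1) compact_imp_closed[OF c]] compact_imp_separable[OF c]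
    by blast
qed

section \<open>From the Wasserstein distance to comparison of measures\<close>

definition prokhorov_close ::
    "'a::metric_space measure \<Rightarrow> 'a measure \<Rightarrow> real \<Rightarrow> real \<Rightarrow> bool" where
  "prokhorov_close \<mu> \<nu> e \<delta> \<longleftrightarrow>
     (\<forall>A\<in>sets borel. \<forall>B\<in>sets borel. (\<forall>x\<in>A. ball x e \<subseteq> B) \<longrightarrow>
        measure \<mu> A \<le> measure \<nu> B + \<delta> \<and> measure \<nu> A \<le> measure \<mu> B + \<delta>)"

lemma prokhorov_close_ball:
  assumes "prokhorov_close \<mu> \<nu> e \<delta>" "dist x y + s + e \<le> r"
  shows "measure \<mu> (ball x s) \<le> measure \<nu> (ball y r) + \<delta>"
    and "measure \<nu> (ball x s) \<le> measure \<mu> (ball y r) + \<delta>"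
proof -
  have "\<forall>z\<in>ball x s. ball z e \<subseteq> ball y r"
  proof (intro ballI subsetI)
    fix z w assume "z \<in> ball x s" "w \<in> ball z e"
    then show "w \<in> ball y r"
      using assms(2) dist_triangle[of y w x] dist_triangle[of x w z] by (simp add: dist_commute)
  qed
  then show "measure \<mu> (ball x s) \<le> measure \<nu> (ball y r) + \<delta>"
    and "measure \<nu> (ball x s) \<le> measure \<mu> (ball y r) + \<delta>"
    using assms(1) by (auto simp: prokhorov_close_def)
qed

lemma dist_coupling_measurable [measurable]:
  "(\<lambda>z::'a::metric_space \<times> 'a. dist (fst z) (snd z)) \<in> borel_measurable borel"
  by (intro borel_measurable_continuous_onI continuous_intros)

lemma prokhorov_close_coupling:
  fixes \<mu> \<nu> :: "'a::metric_space measure"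
  assumes \<kappa>: "\<kappa> \<in> couplings \<mu> \<nu>"
    and tail: "measure \<kappa> {z. e \<le> dist (fst z) (snd z)} \<le> \<delta>"
  shows "prokhorov_close \<mu> \<nu> e \<delta>"
  unfolding prokhorov_close_def
proof (intro ballI impI)
  fix A B :: "'a set"
  assume A: "A \<in> sets borel" and B: "B \<in> sets borel" and AB: "\<forall>x\<in>A. ball x e \<subseteq> B"
  have bp: "borel_prob \<kappa>" and marg: "distr \<kappa> borel fst = \<mu>" "distr \<kappa> borel snd = \<nu>"
    using \<kappa> by (auto simp: couplings_def)
  interpret prob_space \<kappa> using bp borel_prob_measure_simps by blast
  note sp = borel_prob_measure_simps(2,3)[OF bp]
  let ?T = "{z::'a \<times> 'a. e \<le> dist (fst z) (snd z)}"
  have fs: "fst \<in> measurable \<kappa> borel" "snd \<in> measurable \<kappa> borel"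
    using sp by (auto simp: measurable_cong_sets[OF sp(1) refl]
        intro!: borel_measurable_continuous_onI continuous_intros)
  have T: "?T \<in> sets \<kappa>"
    unfolding sp(1) using measurable_sets[OF dist_coupling_measurable, of "{e..}"]
    by (simp add: vimage_def)
  have mu: "measure \<mu> E = measure \<kappa> (fst -` E)" "fst -` E \<in> sets \<kappa>"
    and nu: "measure \<nu> E = measure \<kappa> (snd -` E)" "snd -` E \<in> sets \<kappa>" if "E \<in> sets borel" for E
    using measure_distr[OF fs(1) that] measure_distr[OF fs(2) that] marg sp
      measurable_sets[OF fs(1) that] measurable_sets[OF fs(2) that] by auto
  have bound: "measure \<kappa> E \<le> measure \<kappa> F + \<delta>"
    if "E \<subseteq> F \<union> ?T" "F \<in> sets \<kappa>" for E F
  proof -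
    have "measure \<kappa> E \<le> measure \<kappa> (F \<union> ?T)" using that T by (intro finite_measure_mono) auto
    also have "\<dots> \<le> measure \<kappa> F + measure \<kappa> ?T" using that T by (intro measure_Un_le)
    finally show ?thesis using tail by simp
  qed
  have "fst -` A \<subseteq> snd -` B \<union> ?T" "snd -` A \<subseteq> fst -` B \<union> ?T"
    using AB by (force simp: dist_commute not_le subset_iff)+
  then show "measure \<mu> A \<le> measure \<nu> B + \<delta> \<and> measure \<nu> A \<le> measure \<mu> B + \<delta>"
    using bound mu[OF A] mu[OF B] nu[OF A] nu[OF B] by simp
qed

lemma prokhorov_close_wasserstein:
  fixes \<mu> \<nu> :: "'a::metric_space measure"
  assumes p: "0 < p" and e: "0 < e" and \<delta>: "0 < \<delta>"
    and W: "wasserstein p \<mu> \<nu> < ennreal (e * \<delta> powr (1 / p))"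
  shows "prokhorov_close \<mu> \<nu> e \<delta>"
proof -
  let ?c = "\<lambda>z::'a \<times> 'a. ennreal (dist (fst z) (snd z) powr p)"
  let ?T = "{z::'a \<times> 'a. e \<le> dist (fst z) (snd z)}"
  obtain \<kappa> where \<kappa>: "\<kappa> \<in> couplings \<mu> \<nu>"
    and lt: "ennreal_powr (\<integral>\<^sup>+ z. ?c z \<partial>\<kappa>) (1 / p) < ennreal (e * \<delta> powr (1 / p))"
    using W unfolding wasserstein_def INF_less_iff by blast
  have bp: "borel_prob \<kappa>" using \<kappa> by (simp add: couplings_def)
  interpret prob_space \<kappa> using bp borel_prob_measure_simps by blast
  note sp = borel_prob_measure_simps(2,3)[OF bp]
  define J where "J = enn2real (\<integral>\<^sup>+ z. ?c z \<partial>\<kappa>)"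
  have fin: "(\<integral>\<^sup>+ z. ?c z \<partial>\<kappa>) \<noteq> \<infinity>"
    using lt by (auto simp: ennreal_powr_def)
  then have J: "(\<integral>\<^sup>+ z. ?c z \<partial>\<kappa>) = ennreal J" "J \<ge> 0"
    by (auto simp: J_def less_top)
  have "J powr (1 / p) < e * \<delta> powr (1 / p)"
    using lt fin e by (simp add: ennreal_powr_def J_def[symmetric] ennreal_less_iff)
  then have "(J powr (1 / p)) powr p < (e * \<delta> powr (1 / p)) powr p"
    using p by (intro powr_less_mono2) auto
  then have J_less: "J < e powr p * \<delta>"
    using p e \<delta> J by (simp add: powr_powr powr_mult)
  \<comment> \<open>Markov's inequality for the transport cost\<close>
  have T: "?T \<in> sets \<kappa>"
    unfolding sp(1) using measurable_sets[OF dist_coupling_measurable, of "{e..}"]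
    by (simp add: vimage_def)
  have "ennreal (e powr p * measure \<kappa> ?T) = (\<integral>\<^sup>+ z. ennreal (e powr p) * indicator ?T z \<partial>\<kappa>)"
    using T by (simp add: nn_integral_cmult_indicator emeasure_eq_measure ennreal_mult)
  also have "\<dots> \<le> (\<integral>\<^sup>+ z. ?c z \<partial>\<kappa>)"
    using e p by (intro nn_integral_mono) (auto split: split_indicator intro!: ennreal_leI powr_mono2)
  finally have "e powr p * measure \<kappa> ?T \<le> J" using J by (simp add: ennreal_le_iff)
  then have "e powr p * measure \<kappa> ?T \<le> e powr p * \<delta>" using J_less by simp
  then have "measure \<kappa> ?T \<le> \<delta>" using e by simp
  with \<kappa> show ?thesis by (rule prokhorov_close_coupling)
qed

lemma eventually_prokhorov_close:
  fixes \<mu> :: "'a::metric_space measure"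
  assumes "0 < p" and "(\<lambda>i. wasserstein p (\<mu>s i) \<mu>) \<longlonglongrightarrow> 0" and "0 < e" "0 < \<delta>"
  shows "\<forall>\<^sub>F i in sequentially. prokhorov_close (\<mu>s i) \<mu> e \<delta>"
proof -
  have "(0::ennreal) < ennreal (e * \<delta> powr (1 / p))" using assms by simp
  then have "\<forall>\<^sub>F i in sequentially. wasserstein p (\<mu>s i) \<mu> < ennreal (e * \<delta> powr (1 / p))"
    using order_tendstoD(2)[OF assms(2)] by blast
  then show ?thesis
    by eventually_elim (use assms prokhorov_close_wasserstein in blast)
qed

section \<open>Existence of the support of the limit\<close>

text \<open>A set at positive distance from all \<open>supp \<mu>\<^sub>i\<close> is null for the limit, so the limit
  is carried by the closure of a countable union of compact sets.\<close>

lemma limit_has_support: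
  fixes \<mu> :: "'a::metric_space measure"
  assumes \<mu>s: "\<And>i. borel_prob (\<mu>s i)" "\<And>i. compactly_supported (\<mu>s i)"
    and \<mu>: "borel_prob \<mu>"
    and close: "\<And>e \<delta>. 0 < e \<Longrightarrow> 0 < \<delta> \<Longrightarrow> \<forall>\<^sub>F i in sequentially. prokhorov_close (\<mu>s i) \<mu> e \<delta>"
  shows "has_support \<mu> (supp \<mu>)"
proof -
  interpret prob_space \<mu> using \<mu> borel_prob_measure_simps by blast
  note sp = borel_prob_measure_simps(2,3)[OF \<mu>]
  note sup = compactly_supported_has_support[OF \<mu>s]
  define S where "S = closure (\<Union>i. supp (\<mu>s i))"
  have "closed S" by (simp add: S_def)
  have "S \<noteq> {}" using has_support_nonempty[OF sup(1)[of 0]] by (auto simp: S_def)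
  obtain D where D: "\<And>i. countable (D i)" "\<And>i. supp (\<mu>s i) \<subseteq> closure (D i)"
    using compact_imp_separable[OF sup(2)] by metis
  have "supp (\<mu>s i) \<subseteq> closure (\<Union>i. D i)" for i
    using D(2)[of i] closure_mono[of "D i" "\<Union>i. D i"] by blast
  then have SD: "S \<subseteq> closure (\<Union>i. D i)"
    unfolding S_def by (intro closure_minimal) auto
  define A where "A n = {x. 1 / real (Suc n) \<le> infdist x S}" for n
  have Ameas: "A n \<in> sets borel" for n
    unfolding A_def by (intro borel_closed closed_Collect_le continuous_intros)
  have Anull: "measure \<mu> (A n) = 0" for n
  proof -
    have "measure \<mu> (A n) \<le> 0 + \<delta>" if "\<delta> > 0" for \<delta>
    proof -
      obtain i where i: "prokhorov_close (\<mu>s i) \<mu> (1 / real (Suc n)) \<delta>"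
        using close[of "1 / real (Suc n)" \<delta>] \<open>\<delta> > 0\<close> eventually_happens
        by (metis sequentially_bot zero_less_divide_1_iff of_nat_0_less_iff zero_less_Suc)
      have "\<forall>x\<in>A n. ball x (1 / real (Suc n)) \<subseteq> - S"
      proof (intro ballI subsetI)
        fix x y assume "x \<in> A n" "y \<in> ball x (1 / real (Suc n))"
        then show "y \<in> - S" using infdist_le[of y S x] by (auto simp: A_def)
      qed
      then have le: "measure \<mu> (A n) \<le> measure (\<mu>s i) (- S) + \<delta>"
        using i Ameas \<open>closed S\<close> by (auto simp: prokhorov_close_def)
      have "- S \<in> sets borel" using \<open>closed S\<close> by auto
      moreover have "\<not> (\<exists>x\<in>- S. x \<in> supp (\<mu>s i))"
        using closure_subset[of "\<Union>i. supp (\<mu>s i)"] unfolding S_def by blast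
      ultimately have "measure (\<mu>s i) (- S) = 0"
        using positive_measure_meets_support[OF \<mu>s(1)[of i] sup(1)[of i], of "- S"]
        by (meson zero_less_measure_iff)
      then show ?thesis using le by simp
    qed
    then have "measure \<mu> (A n) \<le> 0" by (rule field_le_epsilon)
    then show ?thesis by (simp add: measure_le_0_iff)
  qed
  have "- S = (\<Union>n. A n)"
  proof (intro set_eqI iffI)
    fix x assume "x \<in> - S"
    then have "0 < infdist x S"
      using in_closed_iff_infdist_zero[OF \<open>closed S\<close> \<open>S \<noteq> {}\<close>, of x] infdist_nonneg[of x S] by auto
    then obtain n where "1 / real (Suc n) < infdist x S" using nat_approx_posE by blast
    then show "x \<in> (\<Union>n. A n)" by (auto simp: A_def intro!: exI[of _ n])
  next
    fix x assume "x \<in> (\<Union>n. A n)"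
    then obtain n where n: "1 / real (Suc n) \<le> infdist x S" by (auto simp: A_def)
    have "0 < 1 / real (Suc n)" by simp
    then have "0 < infdist x S" using n by linarith
    then show "x \<in> - S" by auto
  qed
  then have "measure \<mu> (- S) = 0"
    using Ameas Anull
    by (auto intro!: measure_eq_0_null_sets null_sets_UN simp: null_sets_def sp emeasure_eq_measure)
  then have "measure \<mu> S = 1"
    using prob_compl[of S] \<open>closed S\<close> sp by (simp add: Compl_eq_Diff_UNIV)
  then show ?thesis
    using has_support_supp[OF \<mu> \<open>closed S\<close> _ _ SD] D by simp
qed

section \<open>Real-valued forms of the two conditions\<close>

lemma uniform_ball_mass_iff:
  fixes \<mu>s :: "nat \<Rightarrow> 'a::metric_space measure"
  assumes "\<And>i. prob_space (\<mu>s i)"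
  shows "(INF i. INF x\<in>S i. emeasure (\<mu>s i) (ball x r)) > 0
     \<longleftrightarrow> (\<exists>c>0. \<forall>i. \<forall>x\<in>S i. c \<le> measure (\<mu>s i) (ball x r))" (is "0 < ?m \<longleftrightarrow> ?R")
proof -
  have em: "emeasure (\<mu>s i) E = ennreal (measure (\<mu>s i) E)" for i E
    using assms[of i] by (meson finite_measure.emeasure_eq_measure prob_space.axioms(1))
  show ?thesis
  proof
    assume m: "0 < ?m"
    define c where "c = enn2real (min ?m 1)"
    have "min ?m 1 < \<infinity>" by (simp add: min_less_iff_disj)
    then have c: "ennreal c = min ?m 1" by (simp add: c_def)
    have "0 < ennreal c" using m unfolding c by simp
    then have "0 < c" by simp
    moreover have "c \<le> measure (\<mu>s i) (ball x r)" if "x \<in> S i" for i x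
    proof -
      have "ennreal c \<le> ?m" unfolding c by simp
      also have "?m \<le> emeasure (\<mu>s i) (ball x r)"
        using that by (meson INF_lower INF_lower2 UNIV_I)
      finally show ?thesis by (simp add: em)
    qed
    ultimately show ?R by blast
  next
    assume ?R
    then obtain c where "c > 0" "\<And>i x. x \<in> S i \<Longrightarrow> c \<le> measure (\<mu>s i) (ball x r)" by blast
    then have "ennreal c \<le> ?m" by (intro INF_greatest) (simp add: em ennreal_leI)
    then show "0 < ?m" using \<open>c > 0\<close> by (meson ennreal_less_zero_iff order_less_le_trans)
  qed
qed

lemma hausdorff_dist_tendsto_0_iff:
  "(\<lambda>i. hausdorff_dist (A i) B) \<longlonglongrightarrow> 0 \<longleftrightarrow>
     (\<forall>e>0. \<forall>\<^sub>F i in sequentially. (\<forall>x\<in>A i. infdist x B \<le> e) \<and> (\<forall>y\<in>B. infdist y (A i) \<le> e))"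
proof -
  have le: "hausdorff_dist (A i) B \<le> ennreal e \<longleftrightarrow>
      (\<forall>x\<in>A i. infdist x B \<le> e) \<and> (\<forall>y\<in>B. infdist y (A i) \<le> e)" if "e > 0" for i e
    using that by (simp add: hausdorff_dist_def SUP_le_iff)
  have "(\<lambda>i. hausdorff_dist (A i) B) \<longlonglongrightarrow> 0 \<longleftrightarrow>
     (\<forall>e>0. \<forall>\<^sub>F i in sequentially. hausdorff_dist (A i) B \<le> ennreal e)" (is "?L \<longleftrightarrow> ?R")
  proof
    assume L: ?L
    show ?R
    proof (intro allI impI)
      fix e :: real assume "e > 0"
      then have "\<forall>\<^sub>F i in sequentially. hausdorff_dist (A i) B < ennreal e"
        using order_tendstoD(2)[OF L, of "ennreal e"] by simp
      then show "\<forall>\<^sub>F i in sequentially. hausdorff_dist (A i) B \<le> ennreal e"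
        by eventually_elim simp
    qed
  next
    assume R: ?R
    show ?L
    proof (rule order_tendstoI)
      fix a :: ennreal assume "0 < a"
      then obtain b where "0 < b" "b < a" using dense by blast
      then have b: "ennreal (enn2real b) = b" by (intro ennreal_enn2real) (auto intro: less_le_trans)
      then have "0 < enn2real b" using \<open>0 < b\<close> by (metis ennreal_less_zero_iff)
      then have "\<forall>\<^sub>F i in sequentially. hausdorff_dist (A i) B \<le> b" using R b by metis
      then show "\<forall>\<^sub>F i in sequentially. hausdorff_dist (A i) B < a"
        by eventually_elim (use \<open>b < a\<close> in auto)
    qed simp
  qed
  then show ?thesis using le by simp
qed

lemma infdist_le_imp_near:
  assumes "B \<noteq> {}" "infdist x B \<le> e" "e < r"
  shows "\<exists>y\<in>B. dist x y < r"
  using assms infdist_attains_inf cINF_less_iff[of B "dist x" r]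
  by (auto simp: infdist_def)

section \<open>The two implications\<close>

text \<open>Only points of \<open>F\<close> near \<open>K\<close> matter; a ball around such a point contains a ball around a
  point of \<open>K\<close> and so has positive mass. Finiteness of \<open>F\<close> makes the bound uniform.\<close>

lemma ball_mass_bound_of_finite_net:
  fixes \<mu> :: "'a::metric_space measure"
  assumes "borel_prob \<mu>" and K: "has_support \<mu> K" and "finite F" "0 < s"
    and net: "\<And>y. y \<in> K \<Longrightarrow> \<exists>f\<in>F. dist y f < s"
  shows "\<exists>c>0. \<forall>y\<in>K. c \<le> measure \<mu> (ball y (3 * s))"
proof -
  interpret prob_space \<mu> using assms borel_prob_measure_simps by blast
  note sp = borel_prob_measure_simps(2,3)[OF assms(1)]
  have mono: "measure \<mu> (ball u a) \<le> measure \<mu> (ball v b)" if "dist u v + a \<le> b" for u v a b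
  proof (rule finite_measure_mono)
    show "ball u a \<subseteq> ball v b"
    proof
      fix w assume "w \<in> ball u a"
      then show "w \<in> ball v b" using that dist_triangle[of v w u] by (simp add: dist_commute)
    qed
  qed (simp add: sp)
  define G where "G = {f\<in>F. \<exists>y\<in>K. dist y f < s}"
  \<comment> \<open>inserting 1 avoids a separate case for an empty \<open>G\<close>\<close>
  define c where "c = Min (insert 1 ((\<lambda>f. measure \<mu> (ball f (2 * s))) ` G))"
  have fin: "finite G" using \<open>finite F\<close> by (simp add: G_def)
  have "0 < measure \<mu> (ball f (2 * s))" if f: "f \<in> G" for f
  proof -
    obtain y where y: "y \<in> K" "dist y f < s" using f by (auto simp: G_def)
    have "0 < measure \<mu> (ball y s)" using K y \<open>0 < s\<close> by (auto simp: has_support_def)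
    also have "\<dots> \<le> measure \<mu> (ball f (2 * s))" using y by (intro mono) simp
    finally show ?thesis .
  qed
  then have "0 < c" using fin by (simp add: c_def)
  moreover have "c \<le> measure \<mu> (ball y (3 * s))" if y: "y \<in> K" for y
  proof -
    obtain f where f: "f \<in> F" "dist y f < s" using net y by blast
    then have "f \<in> G" using y by (auto simp: G_def)
    then have "c \<le> measure \<mu> (ball f (2 * s))" using fin by (auto simp: c_def intro!: Min_le)
    also have "\<dots> \<le> measure \<mu> (ball y (3 * s))" using f by (intro mono) (simp add: dist_commute)
    finally show ?thesis .
  qed
  ultimately show ?thesis by blast
qed

lemma finite_net_compact:
  fixes C :: "'a::metric_space set"
  assumes "compact C" "0 < s"
  shows "\<exists>F. finite F \<and> (\<forall>y\<in>C. \<exists>f\<in>F. dist y f < s)"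
proof -
  obtain F where "finite F" "C \<subseteq> (\<Union>x\<in>F. ball x s)"
    using assms unfolding compact_eq_totally_bounded by blast
  then show ?thesis by (intro exI[of _ F]) (force simp: dist_commute)
qed

lemma uniform_ball_mass_of_hausdorff:
  fixes \<mu> :: "'a::metric_space measure"
  assumes \<mu>s: "\<And>i. borel_prob (\<mu>s i)" "\<And>i. has_support (\<mu>s i) (S i)" "\<And>i. compact (S i)"
    and \<mu>: "borel_prob \<mu>" "has_support \<mu> K"
    and close: "\<And>e \<delta>. 0 < e \<Longrightarrow> 0 < \<delta> \<Longrightarrow> \<forall>\<^sub>F i in sequentially. prokhorov_close (\<mu>s i) \<mu> e \<delta>"
    and H: "\<And>e. 0 < e \<Longrightarrow> \<forall>\<^sub>F i in sequentially.
              (\<forall>x\<in>S i. infdist x K \<le> e) \<and> (\<forall>y\<in>K. infdist y (S i) \<le> e)"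
    and "0 < r"
  shows "\<exists>c>0. \<forall>i. \<forall>x\<in>S i. c \<le> measure (\<mu>s i) (ball x r)"
proof -
  note ne = has_support_nonempty[OF \<mu>(2)] has_support_nonempty[OF \<mu>s(2)]
  \<comment> \<open>A finite net of one compact support close to \<open>K\<close> is also a net for \<open>K\<close>.\<close>
  define s where "s = r / 12"
  have "s > 0" using \<open>0 < r\<close> by (simp add: s_def)
  obtain j where j: "\<forall>y\<in>K. infdist y (S j) \<le> s / 4"
    using eventually_happens[OF H[of "s / 4"]] \<open>s > 0\<close> by auto
  obtain F where F: "finite F" "\<forall>y\<in>S j. \<exists>f\<in>F. dist y f < s / 2"
    using finite_net_compact[OF \<mu>s(3)[of j], of "s / 2"] \<open>s > 0\<close> by auto
  have "\<exists>f\<in>F. dist y f < s" if y: "y \<in> K" for y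
  proof -
    obtain x where x: "x \<in> S j" "dist y x < s / 2"
      using infdist_le_imp_near[OF ne(2)[of j], of y "s / 4" "s / 2"] j y \<open>s > 0\<close> by auto
    obtain f where "f \<in> F" "dist x f < s / 2" using F x by blast
    then show ?thesis using x dist_triangle[of y f x] by force
  qed
  then obtain m where "m > 0" and m: "\<And>y. y \<in> K \<Longrightarrow> m \<le> measure \<mu> (ball y (3 * s))"
    using ball_mass_bound_of_finite_net[OF \<mu> F(1) \<open>s > 0\<close>] by blast
  have r4: "0 < r / 4" and m2: "0 < m / 2" using \<open>0 < r\<close> \<open>0 < m\<close> by auto
  have "\<forall>\<^sub>F i in sequentially. \<forall>x\<in>S i. m / 2 \<le> measure (\<mu>s i) (ball x r)"
    using H[OF r4] close[OF r4 m2]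
  proof eventually_elim
    case (elim i)
    show ?case
    proof
      fix x assume "x \<in> S i"
      then obtain y where y: "y \<in> K" "dist x y < r / 2"
        using infdist_le_imp_near[OF ne(1), of x "r / 4" "r / 2"] elim \<open>0 < r\<close> by auto
      have "measure \<mu> (ball y (3 * s)) \<le> measure (\<mu>s i) (ball x r) + m / 2"
        using y by (intro prokhorov_close_ball(2)[where e = "r / 4"])
                   (use elim in \<open>auto simp: s_def dist_commute\<close>)
      then show "m / 2 \<le> measure (\<mu>s i) (ball x r)" using m[OF y(1)] by simp
    qed
  qed
  then obtain N where N: "\<And>i x. i \<ge> N \<Longrightarrow> x \<in> S i \<Longrightarrow> m / 2 \<le> measure (\<mu>s i) (ball x r)"
    by (auto simp: eventually_sequentially)
  have "\<exists>c>0. \<forall>x\<in>S i. c \<le> measure (\<mu>s i) (ball x r)" for i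
  proof -
    obtain F where "finite F" "\<And>y. y \<in> S i \<Longrightarrow> \<exists>f\<in>F. dist y f < r / 3"
      using finite_net_compact[OF \<mu>s(3)[of i], of "r / 3"] \<open>0 < r\<close> by auto
    then show ?thesis
      using ball_mass_bound_of_finite_net[OF \<mu>s(1,2)[of i], of F "r / 3"] \<open>0 < r\<close> by simp
  qed
  then obtain c where c: "\<And>i. 0 < c i" "\<And>i x. x \<in> S i \<Longrightarrow> c i \<le> measure (\<mu>s i) (ball x r)"
    by metis
  define d where "d = Min (insert (m / 2) (c ` {..<N}))"
  have "0 < d" using c \<open>0 < m\<close> by (simp add: d_def)
  moreover have "d \<le> measure (\<mu>s i) (ball x r)" if "x \<in> S i" for i x
  proof (cases "i < N")
    case True
    then have "d \<le> c i" by (auto simp: d_def intro!: Min_le)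
    then show ?thesis using c(2)[OF that] by simp
  next
    case False
    have "d \<le> m / 2" unfolding d_def by (intro Min_le) auto
    then show ?thesis using N[of i x] False that by simp
  qed
  ultimately show ?thesis by blast
qed

text \<open>When \<open>\<nu>\<close> puts more than \<open>\<delta>\<close> on a ball, part of that mass must come from \<open>\<mu>\<close>-mass nearby.
  Both orientations of closeness are admitted because the lemma is used with either measure
  in the role of \<open>\<mu>\<close>.\<close>

lemma support_near_support:
  fixes \<mu> \<nu> :: "'a::metric_space measure"
  assumes "prokhorov_close \<nu> \<mu> e \<delta> \<or> prokhorov_close \<mu> \<nu> e \<delta>"
    and \<mu>: "borel_prob \<mu>" "has_support \<mu> K"
    and "\<delta> < measure \<nu> (ball x s)" "s + e \<le> r"
  shows "infdist x K \<le> r"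
proof -
  have "measure \<nu> (ball x s) \<le> measure \<mu> (ball x r) + \<delta>"
    using assms(1,5) prokhorov_close_ball[of _ _ e \<delta> x x s r] by auto
  then have "0 < measure \<mu> (ball x r)" using assms(4) by simp
  then obtain y where "y \<in> ball x r" "y \<in> K"
    using positive_measure_meets_support[OF \<mu>, of "ball x r"] by auto
  then show ?thesis using infdist_le[of y K x] by simp
qed

lemma hausdorff_of_uniform_ball_mass:
  fixes \<mu> :: "'a::metric_space measure"
  assumes \<mu>s: "\<And>i. borel_prob (\<mu>s i)" "\<And>i. has_support (\<mu>s i) (S i)"
    and \<mu>: "borel_prob \<mu>" "has_support \<mu> K"
    and close: "\<And>e \<delta>. 0 < e \<Longrightarrow> 0 < \<delta> \<Longrightarrow> \<forall>\<^sub>F i in sequentially. prokhorov_close (\<mu>s i) \<mu> e \<delta>"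
    and mass: "\<And>r. 0 < r \<Longrightarrow> \<exists>c>0. \<forall>i. \<forall>x\<in>S i. c \<le> measure (\<mu>s i) (ball x r)"
    and "0 < e"
  shows "\<forall>\<^sub>F i in sequentially. (\<forall>x\<in>S i. infdist x K \<le> e) \<and> (\<forall>y\<in>K. infdist y (S i) \<le> e)"
proof -
  define s where "s = e / 6"
  have "0 < s" using \<open>0 < e\<close> by (simp add: s_def)
  obtain c where "0 < c" and c: "\<And>i x. x \<in> S i \<Longrightarrow> c \<le> measure (\<mu>s i) (ball x s)"
    using mass[OF \<open>0 < s\<close>] by blast
  \<comment> \<open>The limit inherits the lower bound: pass from \<open>y\<close> to a nearby point \<open>x\<close> of some
    \<open>S j\<close>, with \<open>j\<close> depending on \<open>y\<close>, and back.\<close>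
  have mass_limit: "c / 2 \<le> measure \<mu> (ball y (4 * s))" if "y \<in> K" for y
  proof -
    define a where "a = measure \<mu> (ball y s)"
    have "0 < a" using \<mu>(2) that \<open>0 < s\<close> by (auto simp: a_def has_support_def)
    then have "\<forall>\<^sub>F j in sequentially. prokhorov_close (\<mu>s j) \<mu> s (min (a / 2) (c / 2))"
      using close \<open>0 < s\<close> \<open>0 < c\<close> by simp
    then obtain j where j: "prokhorov_close (\<mu>s j) \<mu> s (min (a / 2) (c / 2))"
      using eventually_happens by force
    have "a \<le> measure (\<mu>s j) (ball y (2 * s)) + min (a / 2) (c / 2)"
      unfolding a_def by (rule prokhorov_close_ball(2)[OF j[unfolded a_def]]) simp
    then have "0 < measure (\<mu>s j) (ball y (2 * s))" using \<open>0 < a\<close> by linarith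
    then obtain x where x: "x \<in> ball y (2 * s)" "x \<in> S j"
      using positive_measure_meets_support[OF \<mu>s(1,2)[of j], of "ball y (2 * s)"] by auto
    have "measure (\<mu>s j) (ball x s) \<le> measure \<mu> (ball y (4 * s)) + min (a / 2) (c / 2)"
      using x by (intro prokhorov_close_ball(1)[OF j]) (simp add: dist_commute)
    then show ?thesis using c[OF x(2)] by linarith
  qed
  have "\<forall>\<^sub>F i in sequentially. prokhorov_close (\<mu>s i) \<mu> s (c / 4)"
    using close \<open>0 < s\<close> \<open>0 < c\<close> by simp
  then show ?thesis
  proof eventually_elim
    case (elim i)
    have "infdist x K \<le> e" if "x \<in> S i" for x
      using c[OF that] \<open>0 < c\<close> \<open>0 < s\<close>
      by (intro support_near_support[OF disjI1[OF elim] \<mu>, of x s]) (auto simp: s_def)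
    moreover have "infdist y (S i) \<le> e" if "y \<in> K" for y
      using mass_limit[OF that] \<open>0 < c\<close> \<open>0 < s\<close>
      by (intro support_near_support[OF disjI2[OF elim] \<mu>s(1,2), of y "4 * s"]) (auto simp: s_def)
    ultimately show ?case by blast
  qed
qed

theorem lemma2p6:
  fixes p :: real
    and \<mu>s :: "nat \<Rightarrow> 'a::complete_space measure"
    and \<mu> :: "'a measure"
  assumes "1 \<le> p"
    and "\<And>i. borel_prob (\<mu>s i)"
    and "\<And>i. compactly_supported (\<mu>s i)"
    and "borel_prob \<mu>"
    and "(\<lambda>i. wasserstein p (\<mu>s i) \<mu>) \<longlonglongrightarrow> 0"
  shows "(\<forall>r>0. (INF i. INF x\<in>supp (\<mu>s i). emeasure (\<mu>s i) (ball x r)) > 0)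
     \<longleftrightarrow> (\<lambda>i. hausdorff_dist (supp (\<mu>s i)) (supp \<mu>)) \<longlonglongrightarrow> 0"
proof -
  have close: "\<forall>\<^sub>F i in sequentially. prokhorov_close (\<mu>s i) \<mu> e \<delta>" if "0 < e" "0 < \<delta>" for e \<delta>
    using assms(1,5) that by (intro eventually_prokhorov_close) auto
  note sup = compactly_supported_has_support[OF assms(2,3)]
  note limit = limit_has_support[OF assms(2-4) close]
  have mass_iff: "(INF i. INF x\<in>supp (\<mu>s i). emeasure (\<mu>s i) (ball x r)) > 0
      \<longleftrightarrow> (\<exists>c>0. \<forall>i. \<forall>x\<in>supp (\<mu>s i). c \<le> measure (\<mu>s i) (ball x r))" for r
    by (intro uniform_ball_mass_iff borel_prob_measure_simps(1) assms(2))
  show ?thesis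
    unfolding mass_iff hausdorff_dist_tendsto_0_iff
    using uniform_ball_mass_of_hausdorff[OF assms(2) sup assms(4) limit close]
      hausdorff_of_uniform_ball_mass[OF assms(2) sup(1) assms(4) limit close]
    by blast
qed

end
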